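(* Let $\mathcal{A}$ be a strongly connected $d$-dimensional VASS with at least one transition, and assume that on input $\mathcal{A}$ Algorithm 1 (described in the context) returns a tuple $(k,\mathit{tight})\in\mathbb{N}\times\{\mathit{true},\mathit{false}\}$. Then $k\in\{1,\dots,d\}$ and $\mathcal{L}(n)\in\Omega(n^k)$.
   Context: A $d$-dimensional VASS is a pair $\mathcal{A}=(Q,T)$ with $Q$ a finite nonempty set of states and $T\subseteq Q\times\mathbb{Z}^d\times Q$ a finite set of transitions such that every state has an outgoing transition. A configuration is $p\mathbf{v}$ with $p\in Q$, $\mathbf{v}\in\mathbb{N}^d$, of size $\max_i\mathbf{v}(i)$. A computation from $p_0\mathbf{v}_0$ is a sequence of configurations $p_0\mathbf{v}_0,\dots,p_n\mathbf{v}_n$ (vectors in $\mathbb{N}^d$) with transitions $(p_i,\mathbf{u}_{i+1},p_{i+1})\in T$ and $\mathbf{v}_{i+1}=\mathbf{v}_i+\mathbf{u}_{i+1}$; length $n$. $L(p\mathbf{v})\in\mathbb{N}\cup\{\infty\}$ is the least bound on lengths of computations from $p\mathbf{v}$; $\mathcal{L}(n)=\sup\{L(p\mathbf{v}):\text{size}(p\mathbf{v})=n\}$. $g\in\Omega(h)$ means $g(n)\ge b\,h(n)$ for some constant $b>0$ and all sufficiently large $n$. A sub-VASS is a VASS $(Q',T')$ with $Q'\subseteq Q$, $T'\subseteq T$; strongly connected means a nonempty path between any two states; an SCC of a graph $(Q,T')$ is a maximal strongly connected sub-VASS of it. A linear map is $f(p\mathbf{v})=\mathbf{c}_f^\top\mathbf{v}+\mathbf{w}_f(p)$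 with $\mathbf{c}_f\in\mathbb{Q}^d$, $\mathbf{w}_f\in\mathbb{Q}^Q$; a transition $(p,\mathbf{u},q)$ is $f$-ranked if $\mathbf{c}_f^\top\mathbf{u}+\mathbf{w}_f(q)\le\mathbf{w}_f(p)-1$ and $f$-neutral if $\mathbf{c}_f^\top\mathbf{u}+\mathbf{w}_f(q)=\mathbf{w}_f(p)$. A QRF is a linear map with $\mathbf{c}_f\ge\vec0$ such that every transition is $f$-ranked or $f$-neutral; positive if $\mathbf{c}_f>\vec0$. Algorithm 1: set $\mathit{tight}:=\mathit{true}$ iff a positive QRF for $\mathcal{A}$ exists; $k:=\mathrm{Decompose}(\mathcal{A})$; if $k=\infty$ return "non-terminating", else return $(k,\mathit{tight})$. $\mathrm{Decompose}(\mathcal{A})$: pick a QRF $f$ maximizing the number of $f$-ranked transitions; $T_f:=$ set of $f$-neutral transitions; if $T_f$ contains all transitions return $\infty$; if $T_f=\emptyset$ return $1$; otherwise with $\mathcal{A}_1,\dots,\mathcal{A}_\ell$ all SCCs of $(Q,T_f)$ return $1+\max_i\mathrm{Decompose}(\mathcal{A}_i)$. *)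

theory Defs
  imports "HOL-Analysis.Analysis"
begin

type_synonym ('q, 'd) transition = "'q \<times> (int, 'd) vec \<times> 'q"

(* A pair (Q, T); also used for graphs (Q, T') in which some states may lack an outgoing transition. *)
type_synonym ('q, 'd) vass = "'q set \<times> ('q, 'd) transition set"

type_synonym ('q, 'd) config = "'q \<times> (nat, 'd) vec"

(* (c, w) stands for the map p v |-> c^T v + w p; the values of w outside Q are irrelevant. *)
type_synonym ('q, 'd) linear_map = "(rat, 'd) vec \<times> ('q \<Rightarrow> rat)"

abbreviation states :: "('q, 'd::finite) vass \<Rightarrow> 'q set" where
  "states \<equiv> fst"

abbreviation transitions :: "('q, 'd::finite) vass \<Rightarrow> ('q, 'd) transition set" where
  "transitions \<equiv> snd"

definition is_vass :: "('q, 'd::finite) vass \<Rightarrow> bool" where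
  "is_vass A \<longleftrightarrow>
     finite (states A) \<and> states A \<noteq> {} \<and>
     finite (transitions A) \<and> transitions A \<subseteq> states A \<times> UNIV \<times> states A \<and>
     (\<forall>p\<in>states A. \<exists>u q. (p, u, q) \<in> transitions A)"

definition sub_vass :: "('q, 'd::finite) vass \<Rightarrow> ('q, 'd) vass \<Rightarrow> bool" where
  "sub_vass B A \<longleftrightarrow> is_vass B \<and> states B \<subseteq> states A \<and> transitions B \<subseteq> transitions A"

definition edges :: "('q, 'd::finite) vass \<Rightarrow> ('q \<times> 'q) set" where
  "edges A = {(p, q). \<exists>u. (p, u, q) \<in> transitions A}"

definition strongly_connected :: "('q, 'd::finite) vass \<Rightarrow> bool" where
  "strongly_connected A \<longleftrightarrow> (\<forall>p\<in>states A. \<forall>q\<in>states A. (p, q) \<in> (edges A)\<^sup>+)"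

definition sccs :: "('q, 'd::finite) vass \<Rightarrow> ('q, 'd) vass set" where
  "sccs G = {B. sub_vass B G \<and> strongly_connected B \<and>
     (\<forall>C. sub_vass C G \<and> strongly_connected C \<and> sub_vass B C \<longrightarrow> C = B)}"

definition configs :: "('q, 'd::finite) vass \<Rightarrow> ('q, 'd) config set" where
  "configs A = states A \<times> UNIV"

fun conf_size :: "('q, 'd::finite) config \<Rightarrow> nat" where
  "conf_size (p, v) = Max (range (\<lambda>i. v $ i))"

fun step :: "('q, 'd::finite) vass \<Rightarrow> ('q, 'd) config \<Rightarrow> ('q, 'd) config \<Rightarrow> bool" where
  "step A (p, v) (q, v') \<longleftrightarrow>
     (\<exists>u. (p, u, q) \<in> transitions A \<and> (\<forall>i. int (v' $ i) = int (v $ i) + u $ i))"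

definition computation :: "('q, 'd::finite) vass \<Rightarrow> ('q, 'd) config list \<Rightarrow> bool" where
  "computation A cs \<longleftrightarrow> cs \<noteq> [] \<and> set cs \<subseteq> configs A \<and> successively (step A) cs"

(* A computation consisting of n + 1 configurations has length n. *)
definition term_length :: "('q, 'd::finite) vass \<Rightarrow> ('q, 'd) config \<Rightarrow> enat" where
  "term_length A c = (SUP cs\<in>{cs. computation A cs \<and> hd cs = c}. enat (length cs - 1))"

definition term_complexity :: "('q, 'd::finite) vass \<Rightarrow> nat \<Rightarrow> enat" where
  "term_complexity A n = (SUP c\<in>{c \<in> configs A. conf_size c = n}. term_length A c)"

(* The library's Landau symbol does not apply, since g may take the value infinity. *)
definition in_Omega :: "(nat \<Rightarrow> enat) \<Rightarrow> (nat \<Rightarrow> real) \<Rightarrow> bool" where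
  "in_Omega g h \<longleftrightarrow>
     (\<exists>b>0. \<forall>\<^sub>F n in sequentially. ereal_of_enat (g n) \<ge> ereal (b * h n))"

definition weighted :: "(rat, 'd::finite) vec \<Rightarrow> (int, 'd) vec \<Rightarrow> rat" where
  "weighted c u = (\<Sum>i\<in>UNIV. c $ i * of_int (u $ i))"

fun ranked :: "('q, 'd::finite) linear_map \<Rightarrow> ('q, 'd) transition \<Rightarrow> bool" where
  "ranked (c, w) (p, u, q) \<longleftrightarrow> weighted c u + w q \<le> w p - 1"

fun neutral :: "('q, 'd::finite) linear_map \<Rightarrow> ('q, 'd) transition \<Rightarrow> bool" where
  "neutral (c, w) (p, u, q) \<longleftrightarrow> weighted c u + w q = w p"

definition is_qrf :: "('q, 'd::finite) vass \<Rightarrow> ('q, 'd) linear_map \<Rightarrow> bool" where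
  "is_qrf A f \<longleftrightarrow> (\<forall>i. 0 \<le> fst f $ i) \<and> (\<forall>t\<in>transitions A. ranked f t \<or> neutral f t)"

definition is_positive_qrf :: "('q, 'd::finite) vass \<Rightarrow> ('q, 'd) linear_map \<Rightarrow> bool" where
  "is_positive_qrf A f \<longleftrightarrow> is_qrf A f \<and> (\<forall>i. 0 < fst f $ i)"

definition is_max_qrf :: "('q, 'd::finite) vass \<Rightarrow> ('q, 'd) linear_map \<Rightarrow> bool" where
  "is_max_qrf A f \<longleftrightarrow> is_arg_max (\<lambda>f. card {t \<in> transitions A. ranked f t}) (is_qrf A) f"

definition neutrals :: "('q, 'd::finite) vass \<Rightarrow> ('q, 'd) linear_map \<Rightarrow> ('q, 'd) transition set" where
  "neutrals A f = {t \<in> transitions A. neutral f t}"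

(* decompose A k: some run of the procedure, which picks f nondeterministically, returns k on A.
   For maximal f, a nonempty graph of neutral transitions has an SCC, so Max ranges over a nonempty
   finite set: otherwise the graph would be acyclic, and perturbing w would rank more transitions. *)
inductive decompose :: "('q, 'd::finite) vass \<Rightarrow> enat \<Rightarrow> bool" where
  no_ranked:
    "is_max_qrf A f \<Longrightarrow> neutrals A f = transitions A \<Longrightarrow> decompose A \<infinity>"
| all_ranked:
    "is_max_qrf A f \<Longrightarrow> neutrals A f \<noteq> transitions A \<Longrightarrow> neutrals A f = {} \<Longrightarrow> decompose A 1"
| recurse:
    "is_max_qrf A f \<Longrightarrow> neutrals A f \<noteq> transitions A \<Longrightarrow> neutrals A f \<noteq> {} \<Longrightarrow>
     (\<And>B. B \<in> sccs (states A, neutrals A f) \<Longrightarrow> decompose B (r B)) \<Longrightarrow>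
     decompose A (1 + Max (r ` sccs (states A, neutrals A f)))"

datatype result = Non_Terminating | Bound nat bool

inductive algorithm1 :: "('q, 'd::finite) vass \<Rightarrow> result \<Rightarrow> bool" where
  "decompose A \<infinity> \<Longrightarrow> algorithm1 A Non_Terminating"
| "decompose A (enat k) \<Longrightarrow> algorithm1 A (Bound k (\<exists>f. is_positive_qrf A f))"

end

theory Submission
  imports Defs "HOL-Library.Multiset"
begin

text \<open>
  By linear programming duality, the neutral transitions of a QRF with the most ranked transitions
  are exactly the support of some circulation with nonnegative total effect. Suppose that a component
  \<open>B\<close> of the neutral transitions has closed walks of length \<open>n ^ k\<close> that never lose more than
  \<open>O(n)\<close> and whose effect is at least \<open>n\<close> times that of a fixed closed walk \<open>D\<close>. A multiple of the
  circulation contains \<open>D\<close>, and the rest decomposes into closed walks; repeating each of them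
  \<open>n\<close> times makes up for \<open>n\<close> copies of \<open>D\<close>. Such a round costs only the bounded effect of the
  walks that connect its parts, so it can be repeated \<open>n\<close> times, which gives length \<open>n ^ (k + 1)\<close>
  in the enclosing VASS. The bound \<open>k \<le> d\<close> holds because all cycles of \<open>B\<close> are orthogonal to the
  coefficients of the QRF while some cycle of the enclosing VASS is not, so that the span of the cycle
  effects loses dimension in every recursive call.
\<close>

section \<open>Farkas' lemma\<close>

text \<open>Bartl's induction on the number of constraints: if the last constraint \<open>a m\<close> matters, some point
  \<open>z\<close> violates only it, and the others are projected along \<open>z\<close> onto the kernel of \<open>a m\<close>.\<close>

lemma farkas:
  fixes a :: "'j \<Rightarrow> 'i \<Rightarrow> 'a::linordered_field"
  assumes "finite J" and "finite I"
    and "\<And>x. (\<forall>j\<in>J. (\<Sum>i\<in>I. a j i * x i) \<le> 0) \<Longrightarrow> (\<Sum>i\<in>I. b i * x i) \<le> 0"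
  shows "\<exists>l. (\<forall>j\<in>J. 0 \<le> l j) \<and> (\<forall>i\<in>I. b i = (\<Sum>j\<in>J. l j * a j i))"
  using assms(1,3)
proof (induction J arbitrary: a b rule: finite_induct)
  case empty
  \<comment> \<open>Without constraints every point is admissible; testing with \<open>b\<close>
    itself forces \<open>b\<close> to vanish on \<open>I\<close>.\<close>
  have "(\<Sum>i\<in>I. b i * b i) \<le> 0" using empty[of b] by simp
  moreover have "(\<Sum>i\<in>I. b i * b i) \<ge> 0" by (intro sum_nonneg) simp
  ultimately have "(\<Sum>i\<in>I. b i * b i) = 0" by simp
  then have "\<forall>i\<in>I. b i = 0"
    using sum_nonneg_eq_0_iff[OF \<open>finite I\<close>, of "\<lambda>i. b i * b i"] by auto
  then show ?case by simp
next
  case (insert m J)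
  define dot where "dot x y = (\<Sum>i\<in>I. x i * y i)" for x y :: "'i \<Rightarrow> 'a"
  have dot_diff_r: "dot x (\<lambda>i. y i - s * z i) = dot x y - s * dot x z" for x y z s
    by (simp add: dot_def sum_subtractf sum_distrib_left algebra_simps)
  have dot_diff_l: "dot (\<lambda>i. y i - s * z i) x = dot y x - s * dot z x" for x y z s
    by (simp add: dot_def sum_subtractf sum_distrib_left algebra_simps)
  have prem: "dot b x \<le> 0" if "\<forall>j\<in>insert m J. dot (a j) x \<le> 0" for x
    using insert.prems[of x] that unfolding dot_def by blast
  show ?case
  proof (cases "\<forall>x. (\<forall>j\<in>J. dot (a j) x \<le> 0) \<longrightarrow> dot b x \<le> 0")
    case True
    then obtain l where l: "\<forall>j\<in>J. 0 \<le> l j" "\<forall>i\<in>I. b i = (\<Sum>j\<in>J. l j * a j i)"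
      using insert.IH[of a b] unfolding dot_def by blast
    have "(\<Sum>j\<in>insert m J. (l(m := 0)) j * a j i) = (\<Sum>j\<in>J. l j * a j i)" for i
      using insert.hyps by (simp, intro sum.cong) auto
    then show ?thesis
      using l by (intro exI[of _ "l(m := 0)"]) simp
  next
    case False
    then obtain y where y: "\<forall>j\<in>J. dot (a j) y \<le> 0" "dot b y > 0" by (auto simp: not_le)
    with prem[of y] have my: "dot (a m) y > 0" by force
    \<comment> \<open>Rescaling \<open>y\<close> so that \<open>a m\<close> takes the value 1 on it
      turns subtraction of multiples of \<open>z\<close> into a projection onto the kernel of
      \<open>a m\<close>.\<close>
    define s where "s = inverse (dot (a m) y)"
    define z where "z = (\<lambda>i. s * y i)"
    have s: "s > 0" using my by (simp add: s_def)
    have dot_z: "dot x z = s * dot x y" for x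
      by (simp add: dot_def z_def sum_distrib_left algebra_simps)
    have z: "\<forall>j\<in>J. dot (a j) z \<le> 0" "dot b z > 0" "dot (a m) z = 1"
      using y s my unfolding dot_z by (auto simp: mult_le_0_iff s_def)
    define a' where "a' = (\<lambda>j i. a j i - dot (a j) z * a m i)"
    define b' where "b' = (\<lambda>i. b i - dot b z * a m i)"
    have "dot b' x \<le> 0" if x: "\<forall>j\<in>J. dot (a' j) x \<le> 0" for x
    proof -
      \<comment> \<open>The projection of \<open>x\<close> along \<open>z\<close>. Since
        \<open>a' j\<close> and \<open>b'\<close> are \<open>a j\<close> and \<open>b\<close>
        composed with this projection, the premise for all of \<open>insert m J\<close> can be
        applied at \<open>?x\<close>.\<close>
      let ?x = "\<lambda>i. x i - dot (a m) x * z i"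
      have "dot (a j) ?x = dot (a' j) x" for j
        unfolding a'_def dot_diff_r dot_diff_l by simp
      moreover have "dot b ?x = dot b' x"
        unfolding b'_def dot_diff_r dot_diff_l by simp
      moreover have "dot (a m) ?x = 0"
        unfolding dot_diff_r by (simp add: z)
      ultimately show ?thesis using prem[of ?x] x by simp
    qed
    then obtain l where l: "\<forall>j\<in>J. 0 \<le> l j" "\<forall>i\<in>I. b' i = (\<Sum>j\<in>J. l j * a' j i)"
      using insert.IH[of a' b'] unfolding dot_def by blast
    \<comment> \<open>Collects the multiples of \<open>a m\<close> that the projection removed from
      \<open>b\<close> and from the \<open>a j\<close>. The signs of \<open>dot b z\<close> and
      \<open>dot (a j) z\<close> make it nonnegative.\<close>
    define k where "k = dot b z - (\<Sum>j\<in>J. l j * dot (a j) z)"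
    have "(\<Sum>j\<in>J. l j * dot (a j) z) \<le> 0"
      using l z by (intro sum_nonpos) (simp add: mult_nonneg_nonpos)
    then have k: "k \<ge> 0" using z by (simp add: k_def)
    have "b i = (\<Sum>j\<in>insert m J. (l(m := k)) j * a j i)" if "i \<in> I" for i
    proof -
      have "(\<Sum>j\<in>insert m J. (l(m := k)) j * a j i) = k * a m i + (\<Sum>j\<in>J. (l(m := k)) j * a j i)"
        using insert.hyps by simp
      also have "(\<Sum>j\<in>J. (l(m := k)) j * a j i) = (\<Sum>j\<in>J. l j * a j i)"
        using insert.hyps by (intro sum.cong) auto
      also have "k * a m i + \<dots> = dot b z * a m i + (\<Sum>j\<in>J. l j * a' j i)"
        by (simp add: k_def a'_def algebra_simps sum_subtractf sum_distrib_left)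
      also have "(\<Sum>j\<in>J. l j * a' j i) = b' i" using l(2) that by simp
      also have "dot b z * a m i + b' i = b i" by (simp add: b'_def)
      finally show ?thesis by simp
    qed
    then show ?thesis using l(1) k by (intro exI[of _ "l(m := k)"]) auto
  qed
qed

section \<open>Walks and their effects\<close>

abbreviation source :: "('q, 'd::finite) transition \<Rightarrow> 'q" where
  "source t \<equiv> fst t"

abbreviation target :: "('q, 'd::finite) transition \<Rightarrow> 'q" where
  "target t \<equiv> snd (snd t)"

abbreviation update :: "('q, 'd::finite) transition \<Rightarrow> (int, 'd) vec" where
  "update t \<equiv> fst (snd t)"

fun walk :: "('q, 'd::finite) transition set \<Rightarrow> 'q \<Rightarrow> ('q, 'd) transition list \<Rightarrow> 'q \<Rightarrow> bool" where
  "walk T p [] q \<longleftrightarrow> p = q"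
| "walk T p (t # ts) q \<longleftrightarrow> t \<in> T \<and> source t = p \<and> walk T (target t) ts q"

text \<open>Taken on multisets because the order of the transitions does not matter here; walks and
  flows can then be added and subtracted in the same structure.\<close>

definition effect :: "'d::finite \<Rightarrow> ('q, 'd) transition multiset \<Rightarrow> int" where
  "effect i M = (\<Sum>t\<in>#M. update t $ i)"

lemma effect_simps [simp]:
  "effect i {#} = 0"
  "effect i (add_mset t M) = update t $ i + effect i M"
  "effect i (M + N) = effect i M + effect i N"
  by (simp_all add: effect_def)

lemma effect_diff: "N \<subseteq># M \<Longrightarrow> effect i (M - N) = effect i M - effect i N"
  by (metis add_diff_cancel_right' effect_simps(3) subset_mset.diff_add)

lemma effect_repeat [simp]: "effect i (repeat_mset n M) = int n * effect i M"
  by (induction n) (simp_all add: algebra_simps)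

lemma effect_concat_replicate [simp]:
  "effect i (mset (concat (replicate n zs))) = int n * effect i (mset zs)"
  by (induction n) (simp_all add: algebra_simps)

lemma walk_append [simp]:
  "walk T p (xs @ ys) q \<longleftrightarrow> (\<exists>s. walk T p xs s \<and> walk T s ys q)"
  by (induction xs arbitrary: p) auto

lemma walk_mono: "walk T p zs q \<Longrightarrow> T \<subseteq> T' \<Longrightarrow> walk T' p zs q"
  by (induction zs arbitrary: p) auto

lemma walk_subset: "walk T p zs q \<Longrightarrow> set zs \<subseteq> T"
  by (induction zs arbitrary: p) auto

lemma walk_restrict: "walk T p zs q \<Longrightarrow> set zs \<subseteq> S \<Longrightarrow> walk S p zs q"
  by (induction zs arbitrary: p) auto

lemma walk_replicate: "walk T p zs p \<Longrightarrow> walk T p (concat (replicate n zs)) p"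
  by (induction n) auto

lemma length_concat_replicate [simp]: "length (concat (replicate n zs)) = n * length zs"
  by (induction n) auto

lemma walk_source_target:
  "walk T p zs q \<Longrightarrow> add_mset q (image_mset source (mset zs)) = add_mset p (image_mset target (mset zs))"
  by (induction zs arbitrary: p) (auto simp: add_mset_commute)

lemma walk_reachable:
  "walk T p zs q \<Longrightarrow> zs = [] \<and> p = q \<or> zs \<noteq> [] \<and> (p, q) \<in> (edges (Q, T))\<^sup>+"
proof (induction zs arbitrary: p)
  case (Cons t zs)
  then have "(p, target t) \<in> edges (Q, T)"
    by (cases t) (auto simp: edges_def)
  with Cons.IH[of "target t"] Cons.prems show ?case
    by (auto intro: trancl_into_trancl2)
qed simp

lemma walk_of_reachable:
  "(p, q) \<in> (edges A)\<^sup>+ \<Longrightarrow> \<exists>zs. zs \<noteq> [] \<and> walk (transitions A) p zs q"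
proof (induction rule: trancl_induct)
  case (base q)
  then obtain u where "(p, u, q) \<in> transitions A" by (auto simp: edges_def)
  then show ?case by (intro exI[of _ "[(p, u, q)]"]) simp
next
  case (step q r)
  then obtain u zs where "(q, u, r) \<in> transitions A" "walk (transitions A) p zs q"
    by (auto simp: edges_def)
  then show ?case by (intro exI[of _ "zs @ [(q, u, r)]"]) auto
qed

lemma strongly_connected_walk:
  assumes "strongly_connected A" "p \<in> states A" "q \<in> states A"
  obtains zs where "zs \<noteq> []" "walk (transitions A) p zs q"
  using assms walk_of_reachable unfolding strongly_connected_def by metis

section \<open>Balanced multisets of transitions\<close>

text \<open>Every state is entered as often as it is left, so these multisets are the integral
  circulations.\<close>

definition balanced :: "('q, 'd::finite) transition multiset \<Rightarrow> bool" where
  "balanced M \<longleftrightarrow> image_mset source M = image_mset target M"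

lemma balanced_closed_walk: "walk T p zs p \<Longrightarrow> balanced (mset zs)"
  using walk_source_target[of T p zs p] by (simp add: balanced_def)

lemma balanced_diff: "balanced M \<Longrightarrow> balanced N \<Longrightarrow> N \<subseteq># M \<Longrightarrow> balanced (M - N)"
  by (simp add: balanced_def image_mset_Diff)

lemma balanced_repeat: "balanced M \<Longrightarrow> balanced (repeat_mset n M)"
  by (induction n) (simp_all add: balanced_def)

lemma balanced_contains_closed_walk:
  assumes "balanced M" "M \<noteq> {#}"
  obtains p zs where "zs \<noteq> []" "walk (set_mset M) p zs p" "mset zs \<subseteq># M"
proof -
  obtain t where t: "t \<in># M" using assms(2) by auto
  let ?P = "\<lambda>zs. mset zs \<subseteq># M \<and> (\<exists>q. walk (set_mset M) (source t) zs q)"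
  have "?P [t]" using t by simp
  moreover have "\<forall>zs. ?P zs \<longrightarrow> length zs < Suc (size M)"
    by (metis le_imp_less_Suc size_mset size_mset_mono)
  ultimately obtain zs where zs: "?P zs" and longest: "\<forall>ys. ?P ys \<longrightarrow> length ys \<le> length zs"
    using ex_has_greatest_nat[of ?P "[t]" length "Suc (size M)"] by blast
  obtain q where q: "walk (set_mset M) (source t) zs q" using zs by blast
  have "zs \<noteq> []" using longest[rule_format, OF \<open>?P [t]\<close>] by auto
  have "q = source t"
  proof (rule ccontr)
    assume ne: "q \<noteq> source t"
    have "count (add_mset q (image_mset source (mset zs))) q
        = count (add_mset (source t) (image_mset target (mset zs))) q"
      using walk_source_target[OF q] by simp
    then have "count (image_mset source (mset zs)) q < count (image_mset target (mset zs)) q"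
      using ne by simp
    also have "\<dots> \<le> count (image_mset target M) q"
      using zs by (intro mset_subset_eq_count image_mset_subseteq_mono) blast
    also have "\<dots> = count (image_mset source M) q"
      using assms(1) by (simp add: balanced_def)
    finally have "q \<in># image_mset source (M - mset zs)"
      using zs by (simp add: image_mset_Diff in_diff_count)
    then obtain s where s: "s \<in># M - mset zs" "source s = q" by auto
    have "mset (zs @ [s]) \<subseteq># M"
    proof -
      have "mset zs + {#s#} \<subseteq># mset zs + (M - mset zs)" using s(1) by simp
      then show ?thesis using zs by simp
    qed
    moreover have "walk (set_mset M) (source t) (zs @ [s]) (target s)"
      using q s by (auto dest: in_diffD)
    ultimately have "length (zs @ [s]) \<le> length zs" using longest by blast
    then show False by simp
  qed
  then show thesis using that q zs \<open>zs \<noteq> []\<close> by blast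
qed

text \<open>Removing a closed walk leaves a smaller balanced multiset, so closed walks can be split
  off until nothing remains.\<close>

lemma balanced_decomposition:
  assumes "balanced M"
  shows "\<exists>zss. (\<forall>zs\<in>set zss. \<exists>p. zs \<noteq> [] \<and> walk (set_mset M) p zs p) \<and> mset (concat zss) = M"
  using assms
proof (induction "size M" arbitrary: M rule: less_induct)
  case less
  show ?case
  proof (cases "M = {#}")
    case True
    then show ?thesis by (intro exI[of _ "[]"]) simp
  next
    case False
    then obtain p zs where zs: "zs \<noteq> []" "walk (set_mset M) p zs p" "mset zs \<subseteq># M"
      using balanced_contains_closed_walk less.prems by blast
    let ?N = "M - mset zs"
    have "size ?N < size M"
      using zs(1,3) False by (simp add: size_Diff_submset nonempty_has_size)
    moreover have "balanced ?N"
      using balanced_diff[OF less.prems balanced_closed_walk[OF zs(2)] zs(3)] .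
    ultimately obtain zss where zss: "\<forall>zs\<in>set zss. \<exists>p. zs \<noteq> [] \<and> walk (set_mset ?N) p zs p"
      "mset (concat zss) = ?N"
      using less.hyps[of ?N] by blast
    have "set_mset ?N \<subseteq> set_mset M" by (auto dest: in_diffD)
    then have "\<forall>ys\<in>set (zs # zss). \<exists>p. ys \<noteq> [] \<and> walk (set_mset M) p ys p"
      using zss(1) zs(1,2) walk_mono by (metis (no_types, lifting) set_ConsD)
    moreover have "mset (concat (zs # zss)) = M"
      using zss(2) zs(3) by simp
    ultimately show ?thesis by blast
  qed
qed

section \<open>Flows of neutral transitions\<close>

text \<open>The change of the linear map along a transition: being ranked or neutral becomes a
  condition on one number that is linear in the map and telescopes along walks.\<close>

definition gain :: "('q, 'd::finite) linear_map \<Rightarrow> ('q, 'd) transition \<Rightarrow> rat" where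
  "gain f t = weighted (fst f) (update t) + snd f (target t) - snd f (source t)"

lemma ranked_iff_gain: "ranked f t \<longleftrightarrow> gain f t \<le> -1"
  by (cases f; cases t) (auto simp: gain_def)

lemma neutral_iff_gain: "neutral f t \<longleftrightarrow> gain f t = 0"
  by (cases f; cases t) (auto simp: gain_def)

lemma is_qrf_iff_gain:
  "is_qrf A f \<longleftrightarrow> (\<forall>i. 0 \<le> fst f $ i) \<and> (\<forall>t\<in>transitions A. gain f t \<le> -1 \<or> gain f t = 0)"
  by (simp add: is_qrf_def ranked_iff_gain neutral_iff_gain)

lemma gain_add_scaled:
  "gain (\<chi> i. fst f $ i + r * fst g $ i, \<lambda>q. snd f q + r * snd g q) t = gain f t + r * gain g t"
  by (simp add: gain_def weighted_def sum.distrib sum_distrib_left algebra_simps)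

text \<open>Otherwise adding a large multiple of \<open>g\<close> to \<open>f\<close> would give a
  QRF that also ranks \<open>t\<close> and still ranks everything that \<open>f\<close> ranks.
  Negative gains of \<open>g\<close> may exceed -1, which the scaling repairs.\<close>

lemma max_qrf_gain_zero:
  assumes max: "is_max_qrf A f" and fin: "finite (transitions A)"
    and g: "\<forall>i. 0 \<le> fst g $ i" "\<forall>t\<in>transitions A. gain g t \<le> 0"
    and t: "t \<in> neutrals A f"
  shows "gain g t = 0"
proof (rule ccontr)
  assume nz: "gain g t \<noteq> 0"
  \<comment> \<open>The sum dominates each of its terms, so \<open>r\<close> scales every nonzero
    gain of \<open>g\<close> to at most -1.\<close>
  define r where "r = (\<Sum>s\<in>transitions A. inverse \<bar>gain g s\<bar>)"
  have r: "r \<ge> 0" unfolding r_def by (intro sum_nonneg) simp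
  have scaled: "r * gain g s \<le> -1" if "s \<in> transitions A" "gain g s \<noteq> 0" for s
  proof -
    have neg: "gain g s < 0" using g(2) that by force
    have "inverse \<bar>gain g s\<bar> \<le> r"
      unfolding r_def using that fin by (intro member_le_sum) auto
    then have "r * gain g s \<le> inverse \<bar>gain g s\<bar> * gain g s"
      using neg by (intro mult_right_mono_neg) auto
    then show ?thesis using neg by simp
  qed
  define h where "h = (\<chi> i. fst f $ i + r * fst g $ i, \<lambda>q. snd f q + r * snd g q)"
  have h: "gain h s = gain f s + r * gain g s" for s
    unfolding h_def by (rule gain_add_scaled)
  have f: "is_qrf A f" using max by (simp add: is_max_qrf_def is_arg_max_def)
  have le: "r * gain g s \<le> 0" if "s \<in> transitions A" for s
    using r g(2) that by (simp add: mult_nonneg_nonpos)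
  have "is_qrf A h"
    unfolding is_qrf_iff_gain
  proof (intro conjI allI ballI)
    show "0 \<le> fst h $ i" for i using f g(1) r by (simp add: h_def is_qrf_iff_gain)
    fix s assume s: "s \<in> transitions A"
    have "gain f s \<le> -1 \<or> gain f s = 0" using f s by (simp add: is_qrf_iff_gain)
    then show "gain h s \<le> -1 \<or> gain h s = 0"
      using scaled[OF s] le[OF s] unfolding h by (cases "gain g s = 0") auto
  qed
  moreover have "{s \<in> transitions A. ranked f s} \<subset> {s \<in> transitions A. ranked h s}"
  proof
    show "{s \<in> transitions A. ranked f s} \<subseteq> {s \<in> transitions A. ranked h s}"
      using le by (force simp: ranked_iff_gain h)
    have "t \<in> {s \<in> transitions A. ranked h s}" "t \<notin> {s \<in> transitions A. ranked f s}"
      using t scaled[of t] nz by (auto simp: ranked_iff_gain neutrals_def neutral_iff_gain h)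
    then show "{s \<in> transitions A. ranked f s} \<noteq> {s \<in> transitions A. ranked h s}" by blast
  qed
  then have "card {s \<in> transitions A. ranked f s} < card {s \<in> transitions A. ranked h s}"
    using fin by (intro psubset_card_mono) auto
  ultimately show False using max unfolding is_max_qrf_def is_arg_max_def by blast
qed

section \<open>From rational flows to multisets of transitions\<close>

lemma common_denominator:
  fixes x :: "'a \<Rightarrow> rat"
  assumes "finite S"
  shows "\<exists>N::nat. N > 0 \<and> (\<forall>s\<in>S. \<exists>m::int. of_nat N * x s = of_int m)"
  using assms
proof induction
  case empty
  show ?case by (intro exI[of _ 1]) simp
next
  case (insert s S)
  then obtain N :: nat where N: "N > 0" "\<forall>s\<in>S. \<exists>m::int. of_nat N * x s = of_int m" by blast
  obtain a b where ab: "quotient_of (x s) = (a, b)" by fastforce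
  have b: "b > 0" "x s = of_int a / of_int b"
    using ab quotient_of_denom_pos quotient_of_div by blast+
  have "of_nat (N * nat b) * x s = of_int (int N * a)" using b by simp
  moreover have "\<exists>m::int. of_nat (N * nat b) * x t = of_int m" if t: "t \<in> S" for t
  proof -
    obtain m :: int where m: "of_nat N * x t = of_int m" using bspec[OF N(2) t] by blast
    have "of_nat (N * nat b) * x t = of_int b * (of_nat N * x t)" using b(1) by simp
    also have "\<dots> = of_int (b * m)" by (simp add: m)
    finally have "of_nat (N * nat b) * x t = of_int (b * m)" .
    then show ?thesis by blast
  qed
  ultimately have "\<forall>t\<in>insert s S. \<exists>m::int. of_nat (N * nat b) * x t = of_int m"
    by (metis insert_iff)
  then show ?case using N(1) b(1) by (intro exI[of _ "N * nat b"]) auto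
qed

lemma effect_sum_replicate:
  "finite S \<Longrightarrow> effect i (\<Sum>t\<in>S. replicate_mset (y t) t) = (\<Sum>t\<in>S. int (y t) * update t $ i)"
  by (induction S rule: finite_induct) (simp_all add: effect_def)

lemma count_image_sum_replicate:
  "finite S \<Longrightarrow> count (image_mset g (\<Sum>t\<in>S. replicate_mset (y t) t)) s
     = (\<Sum>t\<in>S. y t * of_bool (g t = s))"
  by (induction S rule: finite_induct) auto

lemma set_mset_sum_replicate:
  "finite S \<Longrightarrow> set_mset (\<Sum>t\<in>S. replicate_mset (y t) t) = {t \<in> S. y t > 0}"
  by (induction S rule: finite_induct) auto

text \<open>Column of the transition \<open>t\<close> in the linear program for QRFs, whose variables are the
  coefficients (\<open>Inl\<close>) and the state weights (\<open>Inr\<close>) of the linear map.\<close>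

fun column :: "('q, 'd::finite) transition \<Rightarrow> 'd + 'q \<Rightarrow> rat" where
  "column t (Inl i) = of_int (update t $ i)"
| "column t (Inr s) = of_bool (target t = s) - of_bool (source t = s)"

lemma column_eq_gain:
  assumes "finite Q" "source t \<in> Q" "target t \<in> Q"
  shows "(\<Sum>k\<in>UNIV <+> Q. column t k * x k) = gain (\<chi> i. x (Inl i), \<lambda>s. x (Inr s)) t"
proof -
  have "(\<Sum>s\<in>Q. (of_bool (target t = s) - of_bool (source t = s)) * x (Inr s))
      = (\<Sum>s\<in>Q. of_bool (target t = s) * x (Inr s)) - (\<Sum>s\<in>Q. of_bool (source t = s) * x (Inr s))"
    by (simp add: left_diff_distrib sum_subtractf)
  also have "\<dots> = x (Inr (target t)) - x (Inr (source t))"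
    using assms by (simp add: of_bool_def if_distrib[of "\<lambda>a. a * _"] cong: if_cong)
  finally show ?thesis
    using assms(1) by (simp add: sum.Plus gain_def weighted_def mult.commute)
qed

text \<open>Strict complementarity for the linear program maximised by \<open>f\<close>.\<close>

lemma neutral_flow:
  fixes A :: "('q, 'd::finite) vass"
  assumes A: "is_vass A" and max: "is_max_qrf A f"
  obtains M where "set_mset M = neutrals A f" "balanced M" "\<forall>i. 0 \<le> effect i M"
proof -
  let ?Q = "states A" and ?T = "transitions A" and ?N = "neutrals A f"
  have fin: "finite ?Q" "finite ?T" and sub: "?T \<subseteq> ?Q \<times> UNIV \<times> ?Q"
    using A by (auto simp: is_vass_def)
  have ends: "source t \<in> ?Q" "target t \<in> ?Q" if "t \<in> ?T" for t using sub that by auto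
  have NT: "?N \<subseteq> ?T" by (auto simp: neutrals_def)
  \<comment> \<open>The homogeneous constraints: \<open>Inl t\<close> makes the gain of
    \<open>t\<close> nonpositive, and \<open>Inr i\<close> makes the \<open>i\<close>-th coefficient
    nonnegative.\<close>
  define a :: "('q, 'd) transition + 'd \<Rightarrow> 'd + 'q \<Rightarrow> rat"
    where "a j = (case j of Inl t \<Rightarrow> column t | Inr i \<Rightarrow> (\<lambda>k. - of_bool (k = Inl i)))" for j
  let ?I = "(UNIV :: 'd set) <+> ?Q" and ?J = "?T <+> (UNIV :: 'd set)"
  \<comment> \<open>The premise of Farkas' lemma: any map satisfying the constraints has gain zero
    on all neutral transitions, by maximality of \<open>f\<close>.\<close>
  have "(\<Sum>k\<in>?I. - (\<Sum>t\<in>?N. column t k) * x k) \<le> 0"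
    if x: "\<forall>j\<in>?J. (\<Sum>k\<in>?I. a j k * x k) \<le> 0" for x
  proof -
    define g where "g = (\<chi> i. x (Inl i), \<lambda>s. x (Inr s))"
    have "0 \<le> fst g $ i" for i
    proof -
      have "(\<Sum>k\<in>?I. a (Inr i) k * x k) = - x (Inl i)"
        using fin by (simp add: a_def of_bool_def if_distrib[of "\<lambda>a. - a * _"]
            if_distrib[of "\<lambda>a. a * _"] sum_negf InlI cong: if_cong)
      moreover have "(\<Sum>k\<in>?I. a (Inr i) k * x k) \<le> 0" using x by (rule bspec) (simp add: InrI)
      ultimately show ?thesis by (simp add: g_def)
    qed
    moreover have gain: "(\<Sum>k\<in>?I. column t k * x k) = gain g t" if "t \<in> ?T" for t
      unfolding g_def using column_eq_gain fin ends that by blast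
    moreover have "gain g t \<le> 0" if "t \<in> ?T" for t
      using bspec[OF x, of "Inl t"] that gain[OF that] by (simp add: a_def InlI)
    ultimately have zero: "gain g t = 0" if "t \<in> ?N" for t
      using max_qrf_gain_zero[OF max fin(2), of g] that by blast
    have "(\<Sum>k\<in>?I. (\<Sum>t\<in>?N. column t k) * x k) = (\<Sum>t\<in>?N. \<Sum>k\<in>?I. column t k * x k)"
      unfolding sum_distrib_right by (rule sum.swap)
    also have "\<dots> = 0"
      using gain zero NT by (intro sum.neutral) (metis subsetD)
    finally show ?thesis by (simp add: sum_negf)
  qed
  then obtain l where l: "\<forall>j\<in>?J. 0 \<le> l j"
    "\<forall>k\<in>?I. - (\<Sum>t\<in>?N. column t k) = (\<Sum>j\<in>?J. l j * a j k)"
    using farkas[of ?J ?I a "\<lambda>k. - (\<Sum>t\<in>?N. column t k)"] fin by auto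
  have l_nonneg: "0 \<le> l (Inr i)" "t \<in> ?T \<Longrightarrow> 0 \<le> l (Inl t)" for i t
    using l(1) by (auto simp: InlI InrI)
  \<comment> \<open>The extra 1 moves the sum of the neutral columns to the other side of the Farkas
    identity. What results is a rational circulation, positive on all neutral transitions, whose
    effects are the multipliers \<open>l (Inr i)\<close>.\<close>
  define x where "x t = l (Inl t) + of_bool (t \<in> ?N)" for t
  have x_nonneg: "0 \<le> x t" if "t \<in> ?T" for t
    using l_nonneg(2)[OF that] by (simp add: x_def)
  have x_pos: "0 < x t" if "t \<in> ?N" for t
    using l_nonneg(2)[of t] that NT by (auto simp: x_def)
  have x_col: "(\<Sum>t\<in>?T. x t * column t k) = (\<Sum>i\<in>UNIV. l (Inr i) * of_bool (k = Inl i))"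
    if "k \<in> ?I" for k
  proof -
    have "(\<Sum>t\<in>?T. x t * column t k)
        = (\<Sum>t\<in>?T. l (Inl t) * column t k) + (\<Sum>t\<in>?T. of_bool (t \<in> ?N) * column t k)"
      by (simp add: x_def distrib_right sum.distrib)
    also have "(\<Sum>t\<in>?T. of_bool (t \<in> ?N) * column t k) = (\<Sum>t\<in>?N. column t k)"
      using fin NT by (intro sum.mono_neutral_cong_right) auto
    also have "(\<Sum>t\<in>?T. l (Inl t) * column t k)
        = (\<Sum>j\<in>?J. l j * a j k) + (\<Sum>i\<in>UNIV. l (Inr i) * of_bool (k = Inl i))"
      using fin by (simp add: sum.Plus a_def sum_negf)
    finally show ?thesis using bspec[OF l(2) that] by linarith
  qed
  have x_coef: "(\<Sum>t\<in>?T. x t * of_int (update t $ i)) = l (Inr i)" for i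
    using x_col[of "Inl i"]
    by (simp add: InlI of_bool_def if_distrib[of "\<lambda>a. _ * a"] cong: if_cong)
  have x_state: "(\<Sum>t\<in>?T. x t * (of_bool (target t = s) - of_bool (source t = s))) = 0" for s
  proof (cases "s \<in> ?Q")
    case True
    then show ?thesis using x_col[of "Inr s"] by auto
  next
    case False
    then show ?thesis using ends by (intro sum.neutral) auto
  qed
  \<comment> \<open>Complementary slackness: the gains of \<open>f\<close> weighted by
    \<open>x\<close> sum to a nonnegative number, since coefficients and effects are nonnegative and
    the state weights cancel. Each summand is nonpositive, so each vanishes.\<close>
  have x_ranked: "x t = 0" if "t \<in> ?T" "t \<notin> ?N" for t
  proof -
    have qrf: "is_qrf A f" using max by (simp add: is_max_qrf_def is_arg_max_def)
    define F where "F = case_sum (\<lambda>i. fst f $ i) (snd f)"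
    have F: "gain f t = (\<Sum>k\<in>?I. column t k * F k)" if "t \<in> ?T" for t
      using column_eq_gain[OF fin(1) ends[OF that], of F] by (simp add: F_def gain_def)
    have "(\<Sum>t\<in>?T. x t * gain f t) = (\<Sum>t\<in>?T. \<Sum>k\<in>?I. F k * (x t * column t k))"
      by (intro sum.cong) (simp_all add: F mult_ac sum_distrib_left)
    also have "\<dots> = (\<Sum>k\<in>?I. F k * (\<Sum>t\<in>?T. x t * column t k))"
      unfolding sum_distrib_left by (rule sum.swap)
    also have "\<dots> \<ge> 0"
    proof (intro sum_nonneg)
      fix k assume k: "k \<in> ?I"
      then show "0 \<le> F k * (\<Sum>t\<in>?T. x t * column t k)"
        using l_nonneg(1) qrf x_coef x_state by (cases k) (auto simp: F_def is_qrf_iff_gain)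
    qed
    finally have ge: "0 \<le> (\<Sum>t\<in>?T. x t * gain f t)" .
    have le: "x s * gain f s \<le> 0" if "s \<in> ?T" for s
    proof -
      have "gain f s \<le> -1 \<or> gain f s = 0" using qrf that by (simp add: is_qrf_iff_gain)
      then have "gain f s \<le> 0" by linarith
      then show ?thesis using x_nonneg[OF that] by (intro mult_nonneg_nonpos)
    qed
    then have "(\<Sum>t\<in>?T. x t * gain f t) \<le> 0" by (rule sum_nonpos)
    with ge have "(\<Sum>t\<in>?T. - (x t * gain f t)) = 0" by (simp add: sum_negf)
    then have "x t * gain f t = 0"
      using sum_nonneg_eq_0_iff[OF fin(2), of "\<lambda>t. - (x t * gain f t)"] le \<open>t \<in> ?T\<close> by auto
    moreover have "gain f t \<noteq> 0" using that by (auto simp: neutrals_def neutral_iff_gain)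
    ultimately show ?thesis by simp
  qed
  obtain N :: nat where N: "N > 0" "\<forall>t\<in>?T. \<exists>m::int. of_nat N * x t = of_int m"
    using common_denominator[OF fin(2)] by blast
  \<comment> \<open>The floor is exact, because \<open>N\<close> clears all denominators.\<close>
  define y where "y t = nat \<lfloor>of_nat N * x t\<rfloor>" for t
  have y: "(of_nat (y t) :: rat) = of_nat N * x t" if t: "t \<in> ?T" for t
  proof -
    obtain m :: int where m: "of_nat N * x t = of_int m" using bspec[OF N(2) t] by blast
    then have "m \<ge> 0" using x_nonneg[OF t] by (metis of_int_0_le_iff of_nat_0_le_iff mult_nonneg_nonneg)
    then show ?thesis by (simp add: y_def m)
  qed
  define M where "M = (\<Sum>t\<in>?T. replicate_mset (y t) t)"
  have "0 < y t \<longleftrightarrow> t \<in> ?N" if "t \<in> ?T" for t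
  proof -
    have "0 < y t \<longleftrightarrow> (0::rat) < of_nat (y t)" by simp
    also have "\<dots> \<longleftrightarrow> 0 < x t" unfolding y[OF that] using N(1) by (simp add: zero_less_mult_iff)
    finally show ?thesis using x_pos[of t] x_ranked[OF that] by (cases "t \<in> ?N") simp_all
  qed
  then have "set_mset M = ?N"
    using NT by (auto simp: M_def set_mset_sum_replicate[OF fin(2)])
  moreover have "balanced M"
    unfolding balanced_def
  proof (rule multiset_eqI)
    fix s
    have "(of_nat (\<Sum>t\<in>?T. y t * of_bool (target t = s)) :: rat) - of_nat (\<Sum>t\<in>?T. y t * of_bool (source t = s))
       = (\<Sum>t\<in>?T. of_nat (y t) * (of_bool (target t = s) - of_bool (source t = s)))"
      by (simp add: right_diff_distrib sum_subtractf)
    also have "\<dots> = (\<Sum>t\<in>?T. of_nat N * (x t * (of_bool (target t = s) - of_bool (source t = s))))"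
      using y by (intro sum.cong) auto
    also have "\<dots> = of_nat N * 0"
      unfolding sum_distrib_left[symmetric] x_state ..
    finally have "(\<Sum>t\<in>?T. y t * of_bool (target t = s)) = (\<Sum>t\<in>?T. y t * of_bool (source t = s))"
      by (simp only: mult_zero_right right_minus_eq of_nat_eq_iff)
    then show "count (image_mset source M) s = count (image_mset target M) s"
      by (simp only: M_def count_image_sum_replicate[OF fin(2)])
  qed
  moreover have "0 \<le> effect i M" for i
  proof -
    have "(of_int (effect i M) :: rat) = (\<Sum>t\<in>?T. of_nat (y t) * of_int (update t $ i))"
      by (simp add: M_def effect_sum_replicate[OF fin(2)])
    also have "\<dots> = (\<Sum>t\<in>?T. of_nat N * (x t * of_int (update t $ i)))"
      using y by (intro sum.cong) auto
    also have "\<dots> = of_nat N * l (Inr i)"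
      unfolding sum_distrib_left[symmetric] x_coef ..
    also have "\<dots> \<ge> 0" using l_nonneg(1) by simp
    finally show ?thesis by simp
  qed
  ultimately show thesis using that by blast
qed


section \<open>Strongly connected components\<close>

text \<open>Cutting the walk at an occurrence of a state gives a walk from \<open>p\<close> to that
  state and one back to \<open>p\<close>.\<close>

lemma closed_walk_strongly_connected:
  assumes "walk T p zs p" "zs \<noteq> []"
  shows "is_vass (source ` set zs, set zs)" "strongly_connected (source ` set zs, set zs)"
proof -
  let ?B = "(source ` set zs, set zs)"
  have w: "walk (set zs) p zs p" using walk_restrict[OF assms(1)] by simp
  have "image_mset source (mset zs) = image_mset target (mset zs)"
    using balanced_closed_walk[OF w] by (simp add: balanced_def)
  \<comment> \<open>Every target is thus also a source, so transitions stay inside the state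
    set.\<close>
  then have st: "source ` set zs = target ` set zs"
    by (metis set_image_mset set_mset_mset)
  show "is_vass ?B"
    unfolding is_vass_def using assms(2) st by force
  have to_p: "(s, p) \<in> (edges ?B)\<^sup>+" and from_p: "(p, s) \<in> (edges ?B)\<^sup>*"
    if s: "s \<in> source ` set zs" for s
  proof -
    obtain t where "t \<in> set zs" "source t = s" using s by blast
    then obtain xs ys where t: "source t = s" "zs = xs @ t # ys"
      using split_list by metis
    then have "walk (set zs) p xs s" "walk (set zs) s (t # ys) p"
      using w unfolding t(2) walk_append by auto
    from this[THEN walk_reachable[where Q = "source ` set zs"]]
    show "(s, p) \<in> (edges ?B)\<^sup>+" "(p, s) \<in> (edges ?B)\<^sup>*" by auto
  qed
  then show "strongly_connected ?B"
    unfolding strongly_connected_def by (auto intro: trancl_rtrancl_trancl)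
qed

lemma finite_sccs:
  assumes "finite (states G)" "finite (transitions G)"
  shows "finite (sccs G)"
proof (rule finite_subset)
  show "sccs G \<subseteq> Pow (states G) \<times> Pow (transitions G)"
    by (auto simp: sccs_def sub_vass_def)
qed (use assms in simp)

text \<open>A strongly connected sub-VASS with the largest total number of states and transitions is
  maximal for inclusion.\<close>

lemma sccs_nonempty:
  assumes fin: "finite (states G)" "finite (transitions G)"
    and B: "sub_vass B G" "strongly_connected B"
  shows "sccs G \<noteq> {}"
proof -
  let ?P = "\<lambda>B. sub_vass B G \<and> strongly_connected B"
  let ?size = "\<lambda>B. card (states B) + card (transitions B)"
  have "?size C < Suc (?size G)" if "?P C" for C
    using that fin by (auto simp: sub_vass_def intro!: add_mono card_mono le_imp_less_Suc)
  then obtain M where M: "?P M" "\<forall>C. ?P C \<longrightarrow> ?size C \<le> ?size M"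
    using ex_has_greatest_nat[of ?P B ?size "Suc (?size G)"] B by blast
  have "C = M" if C: "?P C" "sub_vass M C" for C
  proof -
    have sub: "finite (states C)" "finite (transitions C)" "states M \<subseteq> states C" "transitions M \<subseteq> transitions C"
      using C by (auto simp: sub_vass_def is_vass_def)
    then have "card (states M) \<le> card (states C)" "card (transitions M) \<le> card (transitions C)"
      by (auto intro: card_mono)
    moreover have "?size C \<le> ?size M" using M C by blast
    ultimately have "card (states M) = card (states C)" "card (transitions M) = card (transitions C)"
      by linarith+
    with sub have "states M = states C" "transitions M = transitions C"
      by (simp_all add: card_subset_eq)
    then show ?thesis by (simp add: prod_eq_iff)
  qed
  with M have "M \<in> sccs G" by (auto simp: sccs_def)
  then show ?thesis by blast
qed

text \<open>Ensures that the maximum in \<open>decompose\<close> is attained. The flow through all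
  neutral transitions is nonempty and balanced, hence contains a closed walk, whose transitions form
  a strongly connected sub-VASS.\<close>

lemma neutral_sccs_nonempty:
  assumes A: "is_vass A" and max: "is_max_qrf A f" and ne: "neutrals A f \<noteq> {}"
  shows "sccs (states A, neutrals A f) \<noteq> {}"
proof -
  obtain M where M: "set_mset M = neutrals A f" "balanced M" "\<forall>i. 0 \<le> effect i M"
    by (rule neutral_flow[OF A max])
  then have "M \<noteq> {#}" using ne by auto
  then obtain p zs where zs: "zs \<noteq> []" "walk (neutrals A f) p zs p"
    using balanced_contains_closed_walk[OF M(2)] unfolding M(1) by metis
  have sub: "set zs \<subseteq> neutrals A f" "neutrals A f \<subseteq> transitions A"
    using walk_subset[OF zs(2)] by (auto simp: neutrals_def)
  have A': "finite (states A)" "finite (transitions A)" "transitions A \<subseteq> states A \<times> UNIV \<times> states A"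
    using A by (auto simp: is_vass_def)
  have "source ` set zs \<subseteq> states A" using sub A'(3) by fastforce
  then have "sub_vass (source ` set zs, set zs) (states A, neutrals A f)"
    using closed_walk_strongly_connected(1)[OF zs(2,1)] sub(1) by (simp add: sub_vass_def)
  then show ?thesis
    using sccs_nonempty closed_walk_strongly_connected(2)[OF zs(2,1)] A' finite_subset[OF sub(2)]
    by (metis fst_conv snd_conv)
qed

section \<open>Pumping closed walks\<close>

text \<open>For negative \<open>c\<close>, such a walk can be executed from every vector whose
  entries are all at least \<open>- c\<close>.\<close>

definition prefixes_ge :: "int \<Rightarrow> ('q, 'd::finite) transition list \<Rightarrow> bool" where
  "prefixes_ge c zs \<longleftrightarrow> (\<forall>m i. c \<le> effect i (mset (take m zs)))"

lemma effect_ge_length: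
  assumes "\<forall>t\<in>T. \<forall>i. - int K \<le> update t $ i" "set zs \<subseteq> T"
  shows "- int (K * length zs) \<le> effect i (mset zs)"
  using assms(2)
proof (induction zs)
  case (Cons t zs)
  then have "- int K \<le> update t $ i" using assms(1) by auto
  with Cons show ?case by (simp add: algebra_simps)
qed simp

lemma prefixes_ge_length:
  assumes "\<forall>t\<in>T. \<forall>i. - int K \<le> update t $ i" "set zs \<subseteq> T"
  shows "prefixes_ge (- int (K * length zs)) zs"
  unfolding prefixes_ge_def
proof (intro allI)
  fix m i
  have "- int (K * length zs) \<le> - int (K * length (take m zs))" by (simp add: mult_left_mono)
  also have "\<dots> \<le> effect i (mset (take m zs))"
    using assms set_take_subset[of m zs] by (intro effect_ge_length) auto
  finally show "- int (K * length zs) \<le> effect i (mset (take m zs))" .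
qed

lemma prefixes_ge_append:
  assumes xs: "prefixes_ge c xs" and ys: "prefixes_ge d ys"
    and e: "\<forall>i. e \<le> effect i (mset xs)" and b: "b \<le> c" "b \<le> e + d"
  shows "prefixes_ge b (xs @ ys)"
  unfolding prefixes_ge_def
proof (intro allI)
  fix m i
  show "b \<le> effect i (mset (take m (xs @ ys)))"
  proof (cases "m \<le> length xs")
    case True
    then show ?thesis using xs b(1) order_trans by (simp add: prefixes_ge_def) blast
  next
    case False
    have "d \<le> effect i (mset (take (m - length xs) ys))" "e \<le> effect i (mset xs)"
      using ys e by (auto simp: prefixes_ge_def)
    then show ?thesis using b(2) False by simp
  qed
qed

text \<open>A prefix consists of complete copies, each losing at most \<open>e\<close>, and a
  partial copy losing at most \<open>c\<close>.\<close>

lemma prefixes_ge_replicate: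
  assumes ys: "prefixes_ge (- int c) ys" and e: "\<forall>i. - int e \<le> effect i (mset ys)"
  shows "prefixes_ge (- int (n * e + c)) (concat (replicate n ys))"
proof (induction n)
  case 0
  show ?case by (simp add: prefixes_ge_def)
next
  case (Suc n)
  show ?case using prefixes_ge_append[OF ys Suc e] by simp
qed

lemma updates_bounded_below:
  assumes "finite T"
  obtains K :: nat where "\<forall>t\<in>T. \<forall>i. - int K \<le> update t $ i"
proof -
  let ?K = "nat (\<Sum>t\<in>T. \<Sum>i\<in>UNIV. \<bar>update t $ i\<bar>)"
  have "- int ?K \<le> update t $ i" if "t \<in> T" for t i
  proof -
    have "\<bar>update t $ i\<bar> \<le> (\<Sum>i\<in>UNIV. \<bar>update t $ i\<bar>)"
      by (intro member_le_sum) auto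
    also have "\<dots> \<le> (\<Sum>t\<in>T. \<Sum>i\<in>UNIV. \<bar>update t $ i\<bar>)"
      using assms that by (intro member_le_sum) (auto intro: sum_nonneg)
    finally show ?thesis by linarith
  qed
  then show thesis using that by blast
qed

text \<open>The walks witnessing length \<open>n ^ k\<close> lose in total at most \<open>n\<close> times the effect of one fixed
  closed walk, which a nonnegative flow of an enclosing VASS can compensate.\<close>

definition pumpable :: "('q, 'd::finite) vass \<Rightarrow> nat \<Rightarrow> bool" where
  "pumpable A k \<longleftrightarrow> (\<exists>p\<in>states A. \<exists>ds c. walk (transitions A) p ds p \<and>
     (\<forall>n\<ge>1. \<exists>zs. walk (transitions A) p zs p \<and> n ^ k \<le> length zs \<and>
        prefixes_ge (- int (c * n)) zs \<and>
        (\<forall>i. int n * effect i (mset ds) \<le> effect i (mset zs))))"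

lemma pumpable_1:
  assumes A: "is_vass A" and sc: "strongly_connected A"
  shows "pumpable A 1"
proof -
  obtain p where p: "p \<in> states A" using A by (auto simp: is_vass_def)
  obtain ds where ds: "ds \<noteq> []" "walk (transitions A) p ds p"
    using strongly_connected_walk[OF sc p p] by blast
  obtain K where K: "\<forall>t\<in>transitions A. \<forall>i. - int K \<le> update t $ i"
    using updates_bounded_below A unfolding is_vass_def by blast
  have "\<exists>zs. walk (transitions A) p zs p \<and> n ^ 1 \<le> length zs \<and>
        prefixes_ge (- int (K * length ds * n)) zs \<and>
        (\<forall>i. int n * effect i (mset ds) \<le> effect i (mset zs))" for n
  proof (intro exI conjI)
    let ?zs = "concat (replicate n ds)"
    show w: "walk (transitions A) p ?zs p" using walk_replicate[OF ds(2)] .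
    show "n ^ 1 \<le> length ?zs" using ds(1) by (cases ds) auto
    show "prefixes_ge (- int (K * length ds * n)) ?zs"
      using prefixes_ge_length[OF K walk_subset[OF w]] by (simp add: algebra_simps)
  qed simp
  then show ?thesis using p ds(2) unfolding pumpable_def by blast
qed

text \<open>The walk \<open>ds\<close> consists of the connections to and from the cycles. They are
  traversed once however often the cycles are repeated, so their cost does not depend on
  \<open>n\<close>.\<close>

lemma closed_walk_through_cycles:
  assumes sc: "strongly_connected A" and p: "p \<in> states A"
    and "\<forall>zs\<in>set zss. \<exists>q\<in>states A. walk (transitions A) q zs q"
  shows "\<exists>ds. walk (transitions A) p ds p \<and> (\<forall>n. \<exists>ys. walk (transitions A) p ys p \<and>
     length ys = length ds + n * length (concat zss) \<and>
     (\<forall>i. effect i (mset ys) = effect i (mset ds) + int n * effect i (mset (concat zss))))"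
  using assms(3)
proof (induction zss)
  case Nil
  show ?case by (intro exI[of _ "[]"]) (auto intro: exI[of _ "[]"])
next
  case (Cons zs zss)
  then obtain ds where ds: "walk (transitions A) p ds p" and pump: "\<forall>n. \<exists>ys. walk (transitions A) p ys p \<and>
     length ys = length ds + n * length (concat zss) \<and>
     (\<forall>i. effect i (mset ys) = effect i (mset ds) + int n * effect i (mset (concat zss)))" by auto
  obtain q where q: "q \<in> states A" "walk (transitions A) q zs q" using Cons.prems by auto
  obtain xs1 xs2 where xs: "walk (transitions A) p xs1 q" "walk (transitions A) q xs2 p"
    using strongly_connected_walk[OF sc] p q(1) by metis
  show ?case
  proof (rule exI[of _ "xs1 @ xs2 @ ds"], intro conjI allI)
    show "walk (transitions A) p (xs1 @ xs2 @ ds) p" using xs ds by auto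
    fix n
    obtain ys where ys: "walk (transitions A) p ys p" "length ys = length ds + n * length (concat zss)"
     "\<forall>i. effect i (mset ys) = effect i (mset ds) + int n * effect i (mset (concat zss))"
      using pump by blast
    let ?ys = "xs1 @ concat (replicate n zs) @ xs2 @ ys"
    have "walk (transitions A) p ?ys p"
      using xs ys(1) walk_replicate[OF q(2)] by auto
    moreover have "length ?ys = length (xs1 @ xs2 @ ds) + n * length (concat (zs # zss))"
      using ys(2) by (simp add: algebra_simps)
    moreover have "effect i (mset ?ys) = effect i (mset (xs1 @ xs2 @ ds)) + int n * effect i (mset (concat (zs # zss)))" for i
      using ys(3) by (simp add: algebra_simps)
    ultimately show "\<exists>ys. walk (transitions A) p ys p \<and>
       length ys = length (xs1 @ xs2 @ ds) + n * length (concat (zs # zss)) \<and>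
       (\<forall>i. effect i (mset ys) = effect i (mset (xs1 @ xs2 @ ds)) + int n * effect i (mset (concat (zs # zss))))"
      by blast
  qed
qed

lemma pumpable_Suc:
  assumes A: "is_vass A" and sc: "strongly_connected A" and max: "is_max_qrf A f"
    and B: "sub_vass B (states A, neutrals A f)" and pump: "pumpable B k"
  shows "pumpable A (Suc k)"
proof -
  let ?T = "transitions A"
  have BT: "transitions B \<subseteq> neutrals A f" "neutrals A f \<subseteq> ?T"
    using B by (auto simp: sub_vass_def neutrals_def)
  obtain p ds c where p: "p \<in> states B" and ds: "walk (transitions B) p ds p"
    and walks: "\<And>n. n \<ge> 1 \<Longrightarrow> \<exists>zs. walk (transitions B) p zs p \<and> n ^ k \<le> length zs \<and>
        prefixes_ge (- int (c * n)) zs \<and> (\<forall>i. int n * effect i (mset ds) \<le> effect i (mset zs))"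
    using pump unfolding pumpable_def by metis
  have pA: "p \<in> states A" using p B by (auto simp: sub_vass_def)
  obtain M where M: "set_mset M = neutrals A f" "balanced M" "\<forall>i. 0 \<le> effect i M"
    by (rule neutral_flow[OF A max])
  \<comment> \<open>Each transition of \<open>ds\<close> is neutral, hence in \<open>M\<close>, and
    occurs at most \<open>length ds\<close> times in \<open>ds\<close>.\<close>
  have sub: "mset ds \<subseteq># repeat_mset (length ds) M"
  proof (rule mset_subset_eqI)
    fix t
    show "count (mset ds) t \<le> count (repeat_mset (length ds) M) t"
    proof (cases "t \<in> set ds")
      case True
      then have "1 \<le> count M t" using walk_subset[OF ds] BT(1) M(1) by (metis subsetD count_greater_eq_one_iff)
      then have "length ds * 1 \<le> length ds * count M t" by (rule mult_le_mono2)
      then show ?thesis using count_le_length[of ds t] unfolding count_mset count_repeat_mset by linarith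
    next
      case False
      then have "count (mset ds) t = 0" by (rule iffD2[OF count_mset_0_iff])
      then show ?thesis by linarith
    qed
  qed
  let ?X = "repeat_mset (length ds) M - mset ds"
  have "balanced ?X"
    using balanced_diff[OF balanced_repeat[OF M(2)] balanced_closed_walk[OF ds] sub] .
  then obtain zss where zss: "\<forall>zs\<in>set zss. \<exists>q. zs \<noteq> [] \<and> walk (set_mset ?X) q zs q" "mset (concat zss) = ?X"
    using balanced_decomposition by blast
  have "set_mset (repeat_mset n M) \<subseteq> set_mset M" for n by (induction n) auto
  from this[of "length ds"] have X: "set_mset ?X \<subseteq> ?T"
    using BT(2) unfolding M(1) by (force dest: in_diffD)
  have "\<forall>zs\<in>set zss. \<exists>q\<in>states A. walk ?T q zs q"
  proof
    fix zs assume "zs \<in> set zss"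
    then obtain q where q: "zs \<noteq> []" "walk (set_mset ?X) q zs q" using zss(1) by blast
    have w: "walk ?T q zs q" using walk_mono[OF q(2) X] .
    moreover have "q \<in> states A" using q(1) w A by (cases zs) (auto simp: is_vass_def)
    ultimately show "\<exists>q\<in>states A. walk ?T q zs q" by blast
  qed
  from closed_walk_through_cycles[OF sc pA this]
  obtain es where es: "walk ?T p es p" and detour: "\<forall>n. \<exists>ys. walk ?T p ys p \<and>
     length ys = length es + n * length (concat zss) \<and>
     (\<forall>i. effect i (mset ys) = effect i (mset es) + int n * effect i (mset (concat zss)))"
    by (elim exE conjE)
  obtain K where K: "\<forall>t\<in>?T. \<forall>i. - int K \<le> update t $ i"
    using updates_bounded_below A unfolding is_vass_def by blast
  have es_ge: "- int (K * length es) \<le> effect i (mset es)" for i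
    using effect_ge_length[OF K walk_subset[OF es]] .
  let ?L = "length es + length (concat zss)"
  \<comment> \<open>The summands pay for the net loss of up to \<open>n\<close> completed rounds,
    for the drop inside \<open>xs\<close>, and for the drop inside \<open>ys\<close>, whose length
    is at most \<open>?L * n\<close>.\<close>
  let ?c = "K * length es + c + K * ?L"
  have "\<exists>zs. walk ?T p zs p \<and> n ^ Suc k \<le> length zs \<and> prefixes_ge (- int (?c * n)) zs \<and>
     (\<forall>i. int n * effect i (mset es) \<le> effect i (mset zs))" if n: "n \<ge> 1" for n
  proof -
    obtain xs where xs: "walk (transitions B) p xs p" "n ^ k \<le> length xs" "prefixes_ge (- int (c * n)) xs"
      "\<forall>i. int n * effect i (mset ds) \<le> effect i (mset xs)"
      using walks[OF n] by blast
    obtain ys where ys: "walk ?T p ys p" "length ys = length es + n * length (concat zss)"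
      "\<forall>i. effect i (mset ys) = effect i (mset es) + int n * effect i (mset (concat zss))"
      using detour by blast
    let ?round = "xs @ ys"
    have round: "walk ?T p ?round p"
      using walk_mono[OF xs(1)] BT ys(1) by auto
    \<comment> \<open>The cycles in \<open>zss\<close> together with \<open>ds\<close> have the
      nonnegative effect of a multiple of \<open>M\<close>. Repeated \<open>n\<close> times they
      offset the loss of \<open>xs\<close>, and only the effect of \<open>es\<close>
      remains.\<close>
    have round_effect: "effect i (mset es) \<le> effect i (mset ?round)" for i
    proof -
      have "effect i (mset (concat zss)) = int (length ds) * effect i M - effect i (mset ds)"
        unfolding zss(2) effect_diff[OF sub] by simp
      moreover have "0 \<le> int (length ds) * effect i M" using M(3) by simp
      ultimately have "- effect i (mset ds) \<le> effect i (mset (concat zss))" by simp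
      then have "int n * (- effect i (mset ds)) \<le> int n * effect i (mset (concat zss))"
        by (intro mult_left_mono) auto
      then show ?thesis using spec[OF xs(4), of i] spec[OF ys(3), of i] by simp
    qed
    have "length ys \<le> ?L * n"
      using ys(2) n by (simp add: algebra_simps)
    then have "K * length ys \<le> K * (?L * n)" by (rule mult_le_mono2)
    then have ys_ge: "- int (K * (?L * n)) \<le> - int (K * length ys)"
      by (simp only: neg_le_iff_le of_nat_le_iff)
    have "- int (c * n) \<le> effect i (mset xs)" for i
      using xs(3) unfolding prefixes_ge_def by (metis take_all_iff order_refl)
    then have "prefixes_ge (- int (c * n + K * (?L * n))) ?round"
      using ys_ge unfolding of_nat_add
      by (intro allI prefixes_ge_append[OF xs(3) prefixes_ge_length[OF K walk_subset[OF ys(1)]],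
            of "- int (c * n)"]) (assumption | linarith)+
    then have "prefixes_ge (- int (n * (K * length es) + (c * n + K * (?L * n)))) (concat (replicate n ?round))"
      using es_ge round_effect order_trans by (intro prefixes_ge_replicate) blast+
    moreover have "n * (K * length es) + (c * n + K * (?L * n)) = ?c * n"
      by (simp add: algebra_simps)
    ultimately have "prefixes_ge (- int (?c * n)) (concat (replicate n ?round))" by simp
    moreover have "walk ?T p (concat (replicate n ?round)) p"
      using walk_replicate[OF round] .
    moreover have "n ^ Suc k \<le> length (concat (replicate n ?round))"
    proof -
      have "n * n ^ k \<le> n * length ?round" using xs(2) by (intro mult_le_mono2) simp
      then show ?thesis unfolding length_concat_replicate by simp
    qed
    moreover have "int n * effect i (mset es) \<le> effect i (mset (concat (replicate n ?round)))" for i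
      unfolding effect_concat_replicate using round_effect by (intro mult_left_mono) auto
    ultimately show ?thesis by blast
  qed
  then show ?thesis using pA es unfolding pumpable_def by blast
qed


section \<open>From pumpable walks to long computations\<close>

lemma walk_computation:
  assumes A: "is_vass A"
  shows "walk (transitions A) p zs q \<Longrightarrow> p \<in> states A \<Longrightarrow>
    \<forall>m i. 0 \<le> int (v $ i) + effect i (mset (take m zs)) \<Longrightarrow>
    \<exists>cs. computation A cs \<and> hd cs = (p, v) \<and> length cs = Suc (length zs)"
proof (induction zs arbitrary: p v)
  case Nil
  then show ?case by (intro exI[of _ "[(p, v)]"]) (simp add: computation_def configs_def)
next
  case (Cons t zs)
  \<comment> \<open>Here \<open>nat\<close> truncates nothing, by the hypothesis on the prefix of
    length 1.\<close>
  define v' where "v' = (\<chi> i. nat (int (v $ i) + update t $ i))"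
  have t: "t \<in> transitions A" "source t = p" using Cons.prems(1) by auto
  have v': "int (v' $ i) = int (v $ i) + update t $ i" for i
    using spec[OF spec[OF Cons.prems(3), of 1], of i] by (simp add: v'_def)
  have "0 \<le> int (v' $ i) + effect i (mset (take m zs))" for m i
    using spec[OF spec[OF Cons.prems(3), of "Suc m"], of i] v' by (simp add: algebra_simps)
  moreover have "target t \<in> states A" using A t(1) by (auto simp: is_vass_def)
  ultimately obtain cs where cs: "computation A cs" "hd cs = (target t, v')" "length cs = Suc (length zs)"
    using Cons.IH[of "target t" v'] Cons.prems(1) by auto
  have "(p, update t, target t) \<in> transitions A" using t by (metis prod.collapse)
  then have "step A (p, v) (target t, v')" unfolding step.simps using v' by blast
  then have "computation A ((p, v) # cs)"
    using cs Cons.prems(2) by (auto simp: computation_def configs_def successively_Cons)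
  then show ?case using cs(3) by (intro exI[of _ "(p, v) # cs"]) simp
qed

lemma pumpable_in_Omega:
  fixes A :: "('q, 'd::finite) vass"
  assumes A: "is_vass A" and pump: "pumpable A k"
  shows "in_Omega (term_complexity A) (\<lambda>n. real n ^ k)"
proof -
  obtain p c where p: "p \<in> states A" and walks: "\<And>n. n \<ge> 1 \<Longrightarrow> \<exists>zs. walk (transitions A) p zs p \<and>
      n ^ k \<le> length zs \<and> prefixes_ge (- int (c * n)) zs"
    using pump unfolding pumpable_def by metis
  \<comment> \<open>For \<open>n\<close> at least \<open>Suc c\<close>, rounding down in
    \<open>n div Suc c\<close> costs at most a factor 2.\<close>
  define b where "b = 1 / (2 * real (Suc c)) ^ k"
  have "ereal (b * real n ^ k) \<le> ereal_of_enat (term_complexity A n)" if n: "n \<ge> Suc c" for n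
  proof -
    \<comment> \<open>The walk for \<open>m\<close> loses at most \<open>c * m\<close>, which is at
      most \<open>n\<close>, so it can be executed from the vector with all entries
      \<open>n\<close>. Using \<open>Suc c\<close> avoids division by zero.\<close>
    define m where "m = n div Suc c"
    have m: "m \<ge> 1" using n by (simp add: m_def div_greater_zero_iff Suc_le_eq)
    have mn: "Suc c * m \<le> n" unfolding m_def by (rule times_div_less_eq_dividend)
    have "n < Suc c * (m + 1)"
      unfolding m_def using dividend_less_times_div[of "Suc c" n] by (simp add: algebra_simps)
    also have "\<dots> \<le> Suc c * (2 * m)" using m by (intro mult_le_mono2) simp
    finally have "n \<le> 2 * Suc c * m" by (simp add: algebra_simps)
    then have "n ^ k \<le> (2 * Suc c * m) ^ k" by (rule power_mono) simp
    then have "real n ^ k \<le> (2 * real (Suc c)) ^ k * real m ^ k"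
      by (metis of_nat_le_iff of_nat_mult of_nat_numeral of_nat_power power_mult_distrib)
    then have bm: "b * real n ^ k \<le> real (m ^ k)"
      by (simp add: b_def divide_le_eq mult.commute)
    obtain zs where zs: "walk (transitions A) p zs p" "m ^ k \<le> length zs" "prefixes_ge (- int (c * m)) zs"
      using walks[OF m] by blast
    let ?v = "(\<chi> i. n) :: (nat, 'd) vec"
    have cm: "int (c * m) \<le> int n" using mn by (simp only: of_nat_le_iff) simp
    have "0 \<le> int (?v $ i) + effect i (mset (take j zs))" for j i
    proof -
      have "- int (c * m) \<le> effect i (mset (take j zs))"
        using zs(3) by (simp only: prefixes_ge_def)
      then show ?thesis using cm by simp
    qed
    then obtain cs where cs: "computation A cs" "hd cs = (p, ?v)" "length cs = Suc (length zs)"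
      using walk_computation[OF A zs(1) p] by blast
    have "enat (m ^ k) \<le> enat (length cs - 1)" using zs(2) cs(3) by simp
    also have "\<dots> \<le> term_length A (p, ?v)"
      unfolding term_length_def using cs by (intro SUP_upper) simp
    also have "\<dots> \<le> term_complexity A n"
      unfolding term_complexity_def using p by (intro SUP_upper) (simp add: configs_def)
    finally have "ereal_of_enat (enat (m ^ k)) \<le> ereal_of_enat (term_complexity A n)"
      by (simp only: ereal_of_enat_le_iff)
    then show ?thesis using bm by (simp add: order_trans[of _ "ereal (real (m ^ k))"])
  qed
  moreover have "b > 0" by (simp add: b_def)
  ultimately show ?thesis
    unfolding in_Omega_def eventually_sequentially by blast
qed

section \<open>The dimension of the space of cycle effects\<close>

definition cycle_effects :: "('q, 'd::finite) vass \<Rightarrow> (real, 'd) vec set" where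
  "cycle_effects A = {v. \<exists>p zs. walk (transitions A) p zs p \<and> v = (\<chi> i. real_of_int (effect i (mset zs)))}"

lemma walk_gain:
  "walk T p zs q \<Longrightarrow>
    (\<Sum>t\<leftarrow>zs. gain f t) = (\<Sum>i\<in>UNIV. fst f $ i * of_int (effect i (mset zs))) + snd f q - snd f p"
proof (induction zs arbitrary: p)
  case (Cons t zs)
  then have "walk T (target t) zs q" "source t = p" by auto
  then show ?case
    using Cons.IH by (simp add: gain_def[of f t] weighted_def distrib_left sum.distrib)
qed simp

lemma closed_walk_gain:
  assumes "walk T p zs p"
  shows "(\<chi> i. real_of_rat (fst f $ i)) \<bullet> (\<chi> i. real_of_int (effect i (mset zs)))
    = real_of_rat (\<Sum>t\<leftarrow>zs. gain f t)"
  unfolding walk_gain[OF assms] by (simp add: inner_vec_def of_rat_sum of_rat_mult)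

text \<open>Strong connectivity closes a ranked transition to a cycle. No gain is positive, so this
  cycle decreases the linear form and its effect lies outside the hyperplane containing
  \<open>span S\<close>. A general \<open>S\<close> also covers the empty set, needed when the
  recursion ends.\<close>

lemma dim_less_dim_cycle_effects:
  assumes A: "is_vass A" and sc: "strongly_connected A"
    and qrf: "is_qrf A f" "neutrals A f \<noteq> transitions A"
    and S: "S \<subseteq> cycle_effects A" "\<forall>v\<in>S. (\<chi> i. real_of_rat (fst f $ i)) \<bullet> v = 0"
  shows "dim S < dim (cycle_effects A)"
proof -
  let ?c = "\<chi> i. real_of_rat (fst f $ i)"
  obtain t where t: "t \<in> transitions A" "gain f t \<noteq> 0"
    using qrf(2) by (auto simp: neutrals_def neutral_iff_gain)
  have nonpos: "gain f s \<le> 0" if "s \<in> transitions A" for s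
  proof -
    have "gain f s \<le> -1 \<or> gain f s = 0" using qrf(1) that by (simp add: is_qrf_iff_gain)
    then show ?thesis by linarith
  qed
  have "source t \<in> states A" "target t \<in> states A" using A t(1) by (auto simp: is_vass_def)
  then obtain zs where zs: "walk (transitions A) (target t) zs (source t)"
    using strongly_connected_walk[OF sc] by metis
  let ?v = "\<chi> i. real_of_int (effect i (mset (t # zs)))"
  have w: "walk (transitions A) (source t) (t # zs) (source t)" using t zs by simp
  then have v: "?v \<in> cycle_effects A" unfolding cycle_effects_def by blast
  have "(\<Sum>s\<leftarrow>zs. gain f s) \<le> 0"
    using walk_subset[OF zs] nonpos by (intro sum_list_nonpos) auto
  then have "(\<Sum>s\<leftarrow>t # zs. gain f s) < 0" using nonpos[OF t(1)] t(2) by simp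
  then have "?c \<bullet> ?v \<noteq> 0" unfolding closed_walk_gain[OF w] by simp
  moreover have "span S \<subseteq> {v. ?c \<bullet> v = 0}"
    using S(2) by (intro span_minimal subspace_hyperplane) auto
  ultimately have "?v \<notin> span S" by blast
  moreover have "?v \<in> span (cycle_effects A)" using v by (rule span_base)
  ultimately have "span S \<subset> span (cycle_effects A)" using span_mono[OF S(1)] by blast
  then show ?thesis by (rule dim_psubset)
qed

section \<open>The lower bound\<close>

text \<open>The bound uses the dimension of the cycle effects because, unlike \<open>d\<close>, it
  drops in each recursive call. For the length, a single SCC attaining the maximum suffices.\<close>

lemma decompose_lower_bound:
  assumes "decompose A e" "e = enat k" "is_vass A" "strongly_connected A"
  shows "1 \<le> k \<and> k \<le> dim (cycle_effects A) \<and> pumpable A k"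
  using assms
proof (induction arbitrary: k rule: decompose.induct)
  case (no_ranked A f)
  then show ?case by simp
next
  case (all_ranked A f)
  have "is_qrf A f" using all_ranked.hyps(1) by (simp add: is_max_qrf_def is_arg_max_def)
  \<comment> \<open>The empty set has dimension 0, so the strict inequality gives dimension at least
    1.\<close>
  from dim_less_dim_cycle_effects[OF all_ranked.prems(2,3) this all_ranked.hyps(2), of "{}"]
  have "1 \<le> dim (cycle_effects A)" by simp
  moreover have "k = 1" using all_ranked.prems(1) by (simp add: one_enat_def)
  ultimately show ?case using pumpable_1[OF all_ranked.prems(2,3)] by simp
next
  case (recurse A f r)
  let ?S = "sccs (states A, neutrals A f)"
  have NT: "neutrals A f \<subseteq> transitions A" by (auto simp: neutrals_def)
  have qrf: "is_qrf A f" using recurse.hyps(1) by (simp add: is_max_qrf_def is_arg_max_def)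
  have "finite (states A)" "finite (neutrals A f)"
    using recurse.prems(2) NT by (auto simp: is_vass_def intro: finite_subset)
  then have "finite ?S" by (intro finite_sccs) auto
  moreover have "?S \<noteq> {}" using neutral_sccs_nonempty recurse by blast
  ultimately have "Max (r ` ?S) \<in> r ` ?S" by (intro Max_in) auto
  then obtain B where B: "B \<in> ?S" "Max (r ` ?S) = r B" by auto
  obtain j where j: "r B = enat j" "k = Suc j"
    using recurse.prems(1) unfolding B(2) by (cases "r B") (auto simp: one_enat_def)
  have sub: "sub_vass B (states A, neutrals A f)" "is_vass B" "strongly_connected B"
    using B(1) by (auto simp: sccs_def sub_vass_def)
  have IH: "j \<le> dim (cycle_effects B)" "pumpable B j"
    using recurse.IH[OF B(1) j(1) sub(2,3)] by auto
  have BN: "transitions B \<subseteq> neutrals A f" using sub(1) by (simp add: sub_vass_def)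
  have "dim (cycle_effects B) < dim (cycle_effects A)"
  proof (rule dim_less_dim_cycle_effects[OF recurse.prems(2,3) qrf recurse.hyps(2)])
    show "cycle_effects B \<subseteq> cycle_effects A"
      unfolding cycle_effects_def
      by (intro Collect_mono impI) (elim exE conjE, intro exI conjI walk_mono[OF _ order_trans[OF BN NT]])
    show "\<forall>v\<in>cycle_effects B. (\<chi> i. real_of_rat (fst f $ i)) \<bullet> v = 0"
    proof
      fix v assume "v \<in> cycle_effects B"
      then obtain p zs where zs: "walk (transitions B) p zs p" "v = (\<chi> i. real_of_int (effect i (mset zs)))"
        unfolding cycle_effects_def by blast
      have "(\<Sum>t\<leftarrow>zs. gain f t) = (\<Sum>t\<leftarrow>zs. 0)"
        using walk_subset[OF zs(1)] BN
        by (intro arg_cong[of _ _ sum_list] map_cong) (auto simp: neutrals_def neutral_iff_gain)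
      then have "(\<Sum>t\<leftarrow>zs. gain f t) = 0" by (simp only: sum_list_0)
      then show "(\<chi> i. real_of_rat (fst f $ i)) \<bullet> v = 0"
        unfolding zs(2) closed_walk_gain[OF zs(1)] by simp
    qed
  qed
  then show ?case
    using IH(1) pumpable_Suc[OF recurse.prems(2,3) recurse.hyps(1) sub(1) IH(2)] by (simp add: j(2))
qed

theorem mainTheorem6:
  fixes A :: "('q, 'd::finite) vass" and k :: nat and tight :: bool
  assumes "is_vass A"
    and "strongly_connected A"
    and "transitions A \<noteq> {}"
    and "algorithm1 A (Bound k tight)"
  shows "k \<in> {1..CARD('d)} \<and> in_Omega (term_complexity A) (\<lambda>n. real n ^ k)"
proof -
  have "decompose A (enat k)" using assms(4) by (cases rule: algorithm1.cases) auto
  then have "1 \<le> k" "k \<le> dim (cycle_effects A)" "pumpable A k"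
    using decompose_lower_bound assms(1,2) by blast+
  moreover have "dim (cycle_effects A) \<le> CARD('d)"
    using dim_subset_UNIV[of "cycle_effects A"] by simp
  ultimately show ?thesis using pumpable_in_Omega[OF assms(1)] by auto
qed

end
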